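(* Let $\rho$ be a size function on a set $E$. Then its monk $\rho^{\circ}$ is the greatest maxitive measure on $2^E$ below $\rho$; that is, $\rho^{\circ}$ is a maxitive measure with $\rho^{\circ}(A) \leqslant \rho(A)$ for all $A \subseteq E$, and every maxitive measure $\nu$ on $2^E$ such that $\nu(A) \leqslant \rho(A)$ for all $A \subseteq E$ satisfies $\nu(A) \leqslant \rho^{\circ}(A)$ for all $A \subseteq E$.
   Context: $\overline{\mathbb{R}}_+ = \mathbb{R}_+ \cup \{\infty\}$, where $\mathbb{R}_+$ is the set of nonnegative real numbers. A size function on a set $E$ is a map $\rho : 2^E \to \overline{\mathbb{R}}_+$ such that $\rho(\emptyset) = 0$; $\rho(\{x\}) < \infty$ for all $x \in E$; and $\rho(A) \leqslant \rho(A')$ for all subsets $A \subseteq A'$ of $E$. The number $\rho(A)$ is called the size of $A$. The monk of a size function $\rho$ is the map $\rho^{\circ}$ on $2^E$ defined by $\rho^{\circ}(A) = \inf\{ t > 0 : A \text{ is covered by finitely many subsets of } E \text{ of size } \leqslant t \}$, where $t$ ranges over positive reals and $\inf \emptyset = \infty$. A maxitive measure on $2^E$ is a map $\nu : 2^E \to \overline{\mathbb{R}}_+$ such that $\nu(\emptyset) = 0$ and $\nu(A \cup A') = \max(\nu(A), \nu(A'))$ for all subsets $A, A'$ of $E$. *)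

theory Defs
  imports "HOL-Library.Extended_Nonnegative_Real"
begin

text \<open>
  Maps on the power set of \<open>E\<close> are represented by functions on all sets of type \<open>'a set\<close>;
  only their values on subsets of \<open>E\<close> matter.
\<close>

definition size_function :: "'a set \<Rightarrow> ('a set \<Rightarrow> ennreal) \<Rightarrow> bool" where
  "size_function E \<rho> \<longleftrightarrow>
     \<rho> {} = 0 \<and>
     (\<forall>x\<in>E. \<rho> {x} < \<infinity>) \<and>
     (\<forall>A A'. A \<subseteq> A' \<and> A' \<subseteq> E \<longrightarrow> \<rho> A \<le> \<rho> A')"

text \<open>
  The infimum is taken in \<open>ennreal\<close>, where \<open>Inf {} = \<infinity>\<close>, while \<open>t\<close> ranges over positive (finite) reals.
\<close>

definition monk :: "'a set \<Rightarrow> ('a set \<Rightarrow> ennreal) \<Rightarrow> 'a set \<Rightarrow> ennreal" where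
  "monk E \<rho> A =
     Inf {ennreal t | t :: real. 0 < t \<and>
       (\<exists>\<C>. finite \<C> \<and> \<C> \<subseteq> Pow E \<and> (\<forall>C\<in>\<C>. \<rho> C \<le> ennreal t) \<and> A \<subseteq> \<Union>\<C>)}"

definition maxitive_measure :: "'a set \<Rightarrow> ('a set \<Rightarrow> ennreal) \<Rightarrow> bool" where
  "maxitive_measure E \<nu> \<longleftrightarrow>
     \<nu> {} = 0 \<and>
     (\<forall>A A'. A \<subseteq> E \<and> A' \<subseteq> E \<longrightarrow> \<nu> (A \<union> A') = max (\<nu> A) (\<nu> A'))"

end

theory Submission
  imports Defs
begin

text \<open>
  Say that \<open>A\<close> is covered at level \<open>t\<close> when finitely many subsets of \<open>E\<close> of size at most \<open>t\<close>
  cover it. The monk of \<open>A\<close> is the infimum of the positive levels at which \<open>A\<close> is covered.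

  It is maxitive because covers at levels \<open>t\<close> and \<open>t'\<close> of two sets together cover their union at
  level \<open>max t t'\<close> (lemma \<open>covered_at_Un\<close>), while a cover of a union covers each of its parts.
  It lies below \<open>\<rho>\<close> because \<open>A\<close> alone covers itself at every level above \<open>\<rho> A\<close>
  (lemma \<open>monk_le_size\<close>). It is the greatest such measure because a maxitive \<open>\<nu> \<le> \<rho>\<close> cannot
  exceed \<open>t\<close> on a finite union of sets of size at most \<open>t\<close>, so \<open>\<nu> A\<close> is a lower bound of the
  levels at which \<open>A\<close> is covered (lemma \<open>maxitive_le_monk\<close>).
\<close>

definition covered_at :: "'a set \<Rightarrow> ('a set \<Rightarrow> ennreal) \<Rightarrow> real \<Rightarrow> 'a set \<Rightarrow> bool" where
  "covered_at E \<rho> t A \<longleftrightarrow>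
     (\<exists>\<C>. finite \<C> \<and> \<C> \<subseteq> Pow E \<and> (\<forall>C\<in>\<C>. \<rho> C \<le> ennreal t) \<and> A \<subseteq> \<Union>\<C>)"

lemma monk_eq_Inf_covered_at:
  "monk E \<rho> A = Inf {ennreal t | t :: real. 0 < t \<and> covered_at E \<rho> t A}"
  unfolding monk_def covered_at_def ..

lemma covered_at_subset:
  "covered_at E \<rho> t B \<Longrightarrow> A \<subseteq> B \<Longrightarrow> covered_at E \<rho> t A"
  unfolding covered_at_def by (meson subset_trans)

lemma covered_at_Un:
  assumes "covered_at E \<rho> t A" and "covered_at E \<rho> t' B"
  shows "covered_at E \<rho> (max t t') (A \<union> B)"
proof -
  obtain \<C> where C: "finite \<C>" "\<C> \<subseteq> Pow E" "\<forall>C\<in>\<C>. \<rho> C \<le> ennreal t" "A \<subseteq> \<Union>\<C>"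
    using assms(1) unfolding covered_at_def by blast
  obtain \<D> where D: "finite \<D>" "\<D> \<subseteq> Pow E" "\<forall>C\<in>\<D>. \<rho> C \<le> ennreal t'" "B \<subseteq> \<Union>\<D>"
    using assms(2) unfolding covered_at_def by blast
  have "ennreal t \<le> ennreal (max t t')" "ennreal t' \<le> ennreal (max t t')"
    by (auto intro: ennreal_leI)
  then have "\<forall>C\<in>\<C> \<union> \<D>. \<rho> C \<le> ennreal (max t t')"
    using C(3) D(3) by (blast intro: order_trans)
  moreover have "finite (\<C> \<union> \<D>)" "\<C> \<union> \<D> \<subseteq> Pow E" "A \<union> B \<subseteq> \<Union>(\<C> \<union> \<D>)"
    using C D by auto
  ultimately show ?thesis
    unfolding covered_at_def by blast
qed

lemma monk_le:
  "0 < t \<Longrightarrow> covered_at E \<rho> t A \<Longrightarrow> monk E \<rho> A \<le> ennreal t"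
  unfolding monk_eq_Inf_covered_at by (rule Inf_lower) blast

lemma monk_less_iff:
  "monk E \<rho> A < c \<longleftrightarrow> (\<exists>t>0. ennreal t < c \<and> covered_at E \<rho> t A)"
  unfolding monk_eq_Inf_covered_at Inf_less_iff by blast

lemma monk_mono:
  assumes "A \<subseteq> B"
  shows "monk E \<rho> A \<le> monk E \<rho> B"
  unfolding monk_eq_Inf_covered_at
  using covered_at_subset[OF _ assms] by (intro Inf_superset_mono) blast

text \<open>
  The bound is checked against every \<open>c\<close> strictly above the right-hand side, because the infima
  that define the two monks need not be attained.
\<close>

lemma monk_Un_le: "monk E \<rho> (A \<union> B) \<le> max (monk E \<rho> A) (monk E \<rho> B)"
proof (rule dense_ge)
  fix c assume "max (monk E \<rho> A) (monk E \<rho> B) < c"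
  then obtain t t' where t: "0 < t" "ennreal t < c" "covered_at E \<rho> t A"
    and t': "0 < t'" "ennreal t' < c" "covered_at E \<rho> t' B"
    by (auto simp: monk_less_iff)
  have "monk E \<rho> (A \<union> B) \<le> ennreal (max t t')"
    using t t' by (intro monk_le covered_at_Un) auto
  also have "\<dots> \<le> c"
    using t(2) t'(2) by (auto simp: max_def)
  finally show "monk E \<rho> (A \<union> B) \<le> c" .
qed

text \<open>
  The singleton family \<open>{A}\<close> is a cover at every level \<open>t \<ge> \<rho> A\<close>. The level is taken strictly
  above \<open>\<rho> A\<close>, since levels are positive reals and \<open>\<rho> A\<close> may be zero.
\<close>

lemma monk_le_size:
  assumes "A \<subseteq> E"
  shows "monk E \<rho> A \<le> \<rho> A"
proof (rule dense_ge)
  fix c assume "\<rho> A < c"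
  then obtain d where d: "\<rho> A < d" "d < c"
    using dense by blast
  then obtain t where t: "0 \<le> t" "d = ennreal t"
    by (cases d) auto
  have "0 < t"
    using d(1) t by (metis ennreal_0 not_less_zero order_le_less)
  moreover have "covered_at E \<rho> t A"
    unfolding covered_at_def using assms d(1) t(2) by (intro exI[of _ "{A}"]) auto
  ultimately show "monk E \<rho> A \<le> c"
    using monk_le d(2) t(2) by (metis order.strict_implies_order order_trans)
qed

lemma maxitive_measure_mono:
  assumes "maxitive_measure E \<nu>" and "A \<subseteq> B" and "B \<subseteq> E"
  shows "\<nu> A \<le> \<nu> B"
proof -
  have "\<nu> B = max (\<nu> A) (\<nu> B)"
    using assms unfolding maxitive_measure_def by (metis subset_trans sup.absorb2)
  then show ?thesis
    by (metis max.cobounded1)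
qed

lemma maxitive_measure_Union_le:
  assumes "maxitive_measure E \<nu>" and "finite \<C>" and "\<C> \<subseteq> Pow E" and "\<forall>C\<in>\<C>. \<nu> C \<le> c"
  shows "\<nu> (\<Union>\<C>) \<le> c"
  using assms(2-4)
proof (induction \<C> rule: finite_induct)
  case empty
  then show ?case
    using assms(1) by (simp add: maxitive_measure_def)
next
  case (insert C \<C>)
  then have "C \<subseteq> E" and "\<Union>\<C> \<subseteq> E"
    by auto
  then have "\<nu> (C \<union> \<Union>\<C>) = max (\<nu> C) (\<nu> (\<Union>\<C>))"
    using assms(1) by (simp add: maxitive_measure_def)
  then show ?case
    using insert by simp
qed

lemma maxitive_le_monk:
  assumes "maxitive_measure E \<nu>" and le: "\<forall>A\<subseteq>E. \<nu> A \<le> \<rho> A"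
  shows "\<nu> A \<le> monk E \<rho> A"
  unfolding monk_eq_Inf_covered_at
proof (rule Inf_greatest, clarify)
  fix t :: real assume "covered_at E \<rho> t A"
  then obtain \<C> where C: "finite \<C>" "\<C> \<subseteq> Pow E" "\<forall>C\<in>\<C>. \<rho> C \<le> ennreal t" "A \<subseteq> \<Union>\<C>"
    unfolding covered_at_def by blast
  have "\<nu> A \<le> \<nu> (\<Union>\<C>)"
    using C(2,4) by (intro maxitive_measure_mono[OF assms(1)]) auto
  also have "\<dots> \<le> ennreal t"
  proof (rule maxitive_measure_Union_le[OF assms(1) C(1,2)])
    show "\<forall>C\<in>\<C>. \<nu> C \<le> ennreal t"
      using C(2,3) le by (meson PowD order_trans subsetD)
  qed
  finally show "\<nu> A \<le> ennreal t" .
qed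

lemma maxitive_measure_monk:
  assumes "\<rho> {} = 0"
  shows "maxitive_measure E (monk E \<rho>)"
proof -
  have "monk E \<rho> {} = 0"
    using monk_le_size[of "{}" E \<rho>] assms by simp
  moreover have "monk E \<rho> (A \<union> B) = max (monk E \<rho> A) (monk E \<rho> B)" for A B
    by (intro antisym monk_Un_le max.boundedI monk_mono) auto
  ultimately show ?thesis
    by (simp add: maxitive_measure_def)
qed

theorem corollary2p3:
  fixes E :: "'a set" and \<rho> :: "'a set \<Rightarrow> ennreal"
  assumes "size_function E \<rho>"
  shows "maxitive_measure E (monk E \<rho>) \<and>
         (\<forall>A\<subseteq>E. monk E \<rho> A \<le> \<rho> A) \<and>
         (\<forall>\<nu>. maxitive_measure E \<nu> \<and> (\<forall>A\<subseteq>E. \<nu> A \<le> \<rho> A) \<longrightarrow>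
               (\<forall>A\<subseteq>E. \<nu> A \<le> monk E \<rho> A))"
  using assms maxitive_measure_monk[of \<rho> E] monk_le_size[of _ E \<rho>] maxitive_le_monk[of E _ \<rho>]
  by (auto simp: size_function_def)

end
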